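(* Let $s$ be a positive integer. Let $G$ be a plane convex caterpillar with vertices $v_1,\dots,v_s,v_{s+1}$ in clockwise order on the spine such that each of $v_2,\dots,v_s$ has no adjacent leaf. If $s(s+3)\le 2e(G)$, then $G$ is strongly packable.
   Context: Graphs are finite and simple; $e(G)$ is the number of edges of $G$. A convex geometric graph (CGG) is a graph whose vertices are points in strictly convex position in the Euclidean plane and whose edges are straight line segments joining vertices. Its vertices are listed in clockwise cyclic order $u_0,\dots,u_{n-1}$ on the boundary of their convex hull (indices modulo $n$). A pair $\{u_i,u_{i+1}\}$ is an extremal pair. The length $\ell(x,y)$ of a pair of vertices is the minimum length of a path from $x$ to $y$ using only extremal pairs. A CGG is plane if no two of its edges cross. A plane path is a plane CGG whose underlying abstract graph is a path. A convex path is a plane path all of whose edges are extremal. A plane convex caterpillar is a plane CGG (a tree) such that deleting all leaves yields a convex path, called the spine; the spine edges are extremal pairs of the caterpillar itself, i.e. the spine vertices $v_1,\dots,v_{s+1}$ are consecutive in the cyclic order of all vertices of $G$, with spine edges $\{v_i,v_{i+1}\}$. CGGs $G_1,G_2$ are convex-isomorphic if there is a bijection $f:V(G_1)\to V(G_2)$ such that for all $x,y\in V(G_1)$: $\ell(x,y)=\ell(f(x),f(y))$ (lengths taken in $G_1$, resp. $G_2$), and $\{x,y\}\in E(G_1)$ if and only if $\{f(x),f(y)\}\in E(G_2)$. A subgraph of a CGG is regarded as a CGG on its own vertex set with the induced cyclic order. Let $\mathcal{K}_n$ be the complete CGG on $n$ vertices. For a subgraph $G'$ of $\mathcal{K}_n$,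 its length set $L_{G'}\subseteq\{1,\dots,\lfloor n/2\rfloor\}$ is the set of lengths, measured in $\mathcal{K}_n$, of the edges of $G'$. A CGG $G$ is strongly packable if for each $n\ge1$ there is a set $S_n$ of subsets of $\{1,\dots,\lfloor n/2\rfloor\}$ such that: (1) the sets in $S_n$ are pairwise disjoint and each has size $e(G)$; (2) for every $A\in S_n$ there is a subgraph $G_A$ of $\mathcal{K}_n$ convex-isomorphic to $G$ with $L_{G_A}=A$; (3) $\sum_{A\in S_n}|A|=|S_n|\,e(G)=(1-o(1))\,n/2$ as $n\to\infty$. *)

theory Defs
  imports "HOL-Analysis.Analysis" "HOL-Library.Landau_Symbols" "HOL-Library.Disjoint_Sets"
begin

definition strictly_convex_position :: "(real^2) set \<Rightarrow> bool" where
  "strictly_convex_position V \<longleftrightarrow> finite V \<and> (\<forall>x\<in>V. x \<notin> convex hull (V - {x}))"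

text \<open>The triangle \<open>a b c\<close> is traversed clockwise: the determinant of the vectors
  \<open>b - a\<close> and \<open>c - a\<close> is negative.\<close>

definition clockwise :: "real^2 \<Rightarrow> real^2 \<Rightarrow> real^2 \<Rightarrow> bool" where
  "clockwise a b c \<longleftrightarrow>
     (b $ 1 - a $ 1) * (c $ 2 - a $ 2) - (b $ 2 - a $ 2) * (c $ 1 - a $ 1) < 0"

definition clockwise_listing :: "(real^2) list \<Rightarrow> bool" where
  "clockwise_listing us \<longleftrightarrow> distinct us \<and>
     (\<forall>i j k. i < j \<and> j < k \<and> k < length us \<longrightarrow> clockwise (us ! i) (us ! j) (us ! k))"

text \<open>A graph comes with a listing of its vertices in clockwise order. The listing is
  determined by the vertex set up to rotation, and no notion below depends on the
  vertex at which it starts.\<close>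

record cgg =
  vlist :: "(real^2) list"
  edges :: "(real^2) set set"

definition verts :: "cgg \<Rightarrow> (real^2) set" where
  "verts G = set (vlist G)"

definition is_cgg :: "cgg \<Rightarrow> bool" where
  "is_cgg G \<longleftrightarrow> strictly_convex_position (verts G) \<and> clockwise_listing (vlist G) \<and>
     (\<forall>e\<in>edges G. \<exists>x\<in>verts G. \<exists>y\<in>verts G. x \<noteq> y \<and> e = {x, y})"

definition num_edges :: "cgg \<Rightarrow> nat" where
  "num_edges G = card (edges G)"

definition cw_next :: "cgg \<Rightarrow> real^2 \<Rightarrow> real^2 \<Rightarrow> bool" where
  "cw_next G x y \<longleftrightarrow> (\<exists>i < length (vlist G).
     x = vlist G ! i \<and> y = vlist G ! (Suc i mod length (vlist G)))"

definition extremal_pair :: "cgg \<Rightarrow> real^2 \<Rightarrow> real^2 \<Rightarrow> bool" where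
  "extremal_pair G x y \<longleftrightarrow> x \<noteq> y \<and> (cw_next G x y \<or> cw_next G y x)"

definition pair_length :: "cgg \<Rightarrow> real^2 \<Rightarrow> real^2 \<Rightarrow> nat" where
  "pair_length G x y = (LEAST k. \<exists>p. length p = Suc k \<and> distinct p \<and> hd p = x \<and> last p = y \<and>
     (\<forall>i<k. extremal_pair G (p ! i) (p ! Suc i)))"

text \<open>In strictly convex position no three vertices are collinear, so two distinct edges
  cross if and only if the corresponding open segments meet.\<close>

definition plane :: "cgg \<Rightarrow> bool" where
  "plane G \<longleftrightarrow> (\<forall>a b c d. {a, b} \<in> edges G \<and> {c, d} \<in> edges G \<and> {a, b} \<noteq> {c, d} \<longrightarrow>
     open_segment a b \<inter> open_segment c d = {})"

definition convex_isomorphic :: "cgg \<Rightarrow> cgg \<Rightarrow> bool" where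
  "convex_isomorphic G H \<longleftrightarrow> (\<exists>f. bij_betw f (verts G) (verts H) \<and>
     (\<forall>x\<in>verts G. \<forall>y\<in>verts G. pair_length G x y = pair_length H (f x) (f y) \<and>
        ({x, y} \<in> edges G \<longleftrightarrow> {f x, f y} \<in> edges H)))"

definition connected_graph :: "cgg \<Rightarrow> bool" where
  "connected_graph G \<longleftrightarrow>
     (\<forall>x\<in>verts G. \<forall>y\<in>verts G. (x, y) \<in> {(a, b). {a, b} \<in> edges G}\<^sup>*)"

definition acyclic_graph :: "cgg \<Rightarrow> bool" where
  "acyclic_graph G \<longleftrightarrow> \<not> (\<exists>p. length p \<ge> 3 \<and> distinct p \<and>
     (\<forall>i < length p. {p ! i, p ! (Suc i mod length p)} \<in> edges G))"

definition tree :: "cgg \<Rightarrow> bool" where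
  "tree G \<longleftrightarrow> connected_graph G \<and> acyclic_graph G"

definition leaf :: "cgg \<Rightarrow> real^2 \<Rightarrow> bool" where
  "leaf G x \<longleftrightarrow> x \<in> verts G \<and> card {e \<in> edges G. x \<in> e} = 1"

definition delete_leaves :: "cgg \<Rightarrow> cgg" where
  "delete_leaves G =
     \<lparr>vlist = filter (\<lambda>x. \<not> leaf G x) (vlist G), edges = {e \<in> edges G. \<forall>x\<in>e. \<not> leaf G x}\<rparr>"

definition traverses :: "(nat \<Rightarrow> real^2) \<Rightarrow> nat \<Rightarrow> cgg \<Rightarrow> bool" where
  "traverses v s G \<longleftrightarrow> bij_betw v {1..s+1} (verts G) \<and> edges G = {{v i, v (i + 1)} |i. i \<in> {1..s}}"

definition plane_path :: "cgg \<Rightarrow> bool" where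
  "plane_path G \<longleftrightarrow> is_cgg G \<and> plane G \<and> (\<exists>v s. traverses v s G)"

definition convex_path :: "cgg \<Rightarrow> bool" where
  "convex_path G \<longleftrightarrow> plane_path G \<and> (\<forall>x y. {x, y} \<in> edges G \<longrightarrow> extremal_pair G x y)"

text \<open>The last conjunct asks that the spine edges be extremal among all vertices of \<open>G\<close>,
  not only among the spine vertices.\<close>

definition plane_convex_caterpillar :: "cgg \<Rightarrow> bool" where
  "plane_convex_caterpillar G \<longleftrightarrow> is_cgg G \<and> plane G \<and> tree G \<and> convex_path (delete_leaves G) \<and>
     (\<forall>x y. {x, y} \<in> edges (delete_leaves G) \<longrightarrow> extremal_pair G x y)"

definition clockwise_spine :: "cgg \<Rightarrow> nat \<Rightarrow> (nat \<Rightarrow> real^2) \<Rightarrow> bool" where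
  "clockwise_spine G s v \<longleftrightarrow>
     traverses v s (delete_leaves G) \<and> (\<forall>i\<in>{1..s}. cw_next G (v i) (v (i + 1)))"

definition complete_cgg :: "nat \<Rightarrow> cgg \<Rightarrow> bool" where
  "complete_cgg n K \<longleftrightarrow> is_cgg K \<and> card (verts K) = n \<and>
     edges K = {{x, y} |x y. x \<in> verts K \<and> y \<in> verts K \<and> x \<noteq> y}"

text \<open>The cyclic order of a subgraph is automatically the induced one, since \<open>is_cgg H\<close> forces
  its listing to be clockwise.\<close>

definition cgg_subgraph :: "cgg \<Rightarrow> cgg \<Rightarrow> bool" where
  "cgg_subgraph H G \<longleftrightarrow> is_cgg H \<and> verts H \<subseteq> verts G \<and> edges H \<subseteq> edges G"

definition length_set :: "cgg \<Rightarrow> cgg \<Rightarrow> nat set" where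
  "length_set K H = {pair_length K x y |x y. {x, y} \<in> edges H}"

text \<open>The complete graph on \<open>n\<close> vertices is unique up to convex isomorphism; condition (2) is
  required of every realization of it, with the family \<open>S\<close> chosen independently of the
  realization.\<close>

definition strongly_packable :: "cgg \<Rightarrow> bool" where
  "strongly_packable G \<longleftrightarrow> (\<exists>S :: nat \<Rightarrow> nat set set.
     (\<forall>n\<ge>1. S n \<subseteq> Pow {1..n div 2} \<and> disjoint (S n) \<and> (\<forall>A\<in>S n. card A = num_edges G)) \<and>
     (\<forall>n\<ge>1. \<forall>A\<in>S n. \<forall>K. complete_cgg n K \<longrightarrow>
        (\<exists>H. cgg_subgraph H K \<and> convex_isomorphic H G \<and> length_set K H = A)) \<and>
     (\<exists>\<epsilon> :: nat \<Rightarrow> real. \<epsilon> \<in> o(\<lambda>_. 1) \<and>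
        (\<forall>n\<ge>1. real (\<Sum>A\<in>S n. card A) = (1 - \<epsilon> n) * (real n / 2))))"

text \<open>Realizations exist: take points on a parabola.\<close>

lemma ex_complete_cgg: "\<exists>K. complete_cgg n K"
proof -
  define p :: "nat \<Rightarrow> real^2" where "p k = vector [real k, - (real k)\<^sup>2]" for k
  have p1: "p k $ 1 = real k" and p2: "p k $ 2 = - (real k)\<^sup>2" for k
    by (simp_all add: p_def)
  have inj: "inj p"
    by (rule injI) (metis p1 of_nat_eq_iff)
  define us where "us = map p [0..<n]"
  have cw: "clockwise_listing us"
  proof -
    have "clockwise (p i) (p j) (p k)" if "i < j" "j < k" for i j k
    proof -
      have "(real j - real i) * (real k - real i) * (real k - real j) > 0"
        using that by simp
      then show ?thesis
        by (simp add: clockwise_def p1 p2 power2_eq_square algebra_simps)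
    qed
    then show ?thesis
      using inj by (auto simp: clockwise_listing_def us_def distinct_map intro: inj_on_subset)
  qed
  have conv: "strictly_convex_position (set us)"
    unfolding strictly_convex_position_def
  proof (intro conjI ballI)
    fix x assume "x \<in> set us"
    then obtain k where x: "x = p k" by (auto simp: us_def)
    define a :: "real^2" where "a = vector [- 2 * real k, -1]"
    have ip: "a \<bullet> y = - 2 * real k * y $ 1 - y $ 2" for y
      by (simp add: a_def inner_vec_def sum_2)
    have "set us - {x} \<subseteq> {y. a \<bullet> y > - (real k)\<^sup>2}"
    proof
      fix y assume "y \<in> set us - {x}"
      then obtain j where j: "y = p j" "j \<noteq> k" by (auto simp: us_def x)
      then have "(real j - real k)\<^sup>2 > 0" by simp
      then show "y \<in> {y. a \<bullet> y > - (real k)\<^sup>2}"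
        by (simp add: ip j p1 p2 power2_eq_square algebra_simps)
    qed
    then have "convex hull (set us - {x}) \<subseteq> {y. a \<bullet> y > - (real k)\<^sup>2}"
      by (intro hull_minimal convex_halfspace_gt)
    moreover have "x \<notin> {y. a \<bullet> y > - (real k)\<^sup>2}"
      by (simp add: ip x p1 p2 power2_eq_square)
    ultimately show "x \<notin> convex hull (set us - {x})" by blast
  qed simp
  have "card (set us) = n"
    using inj by (simp add: us_def card_image inj_on_subset)
  with cw conv have "complete_cgg n
      \<lparr>vlist = us, edges = {{x, y} |x y. x \<in> set us \<and> y \<in> set us \<and> x \<noteq> y}\<rparr>"
    by (auto simp: complete_cgg_def is_cgg_def verts_def)
  then show ?thesis by blast
qed

end

theory Submission
  imports Defs
begin

text \<open>Planarity forces the leaves of \<open>v\<^sub>s\<^sub>+\<^sub>1\<close> to come directly after the spine in clockwise order,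
  followed by those of \<open>v\<^sub>1\<close>. Hence, to draw \<open>G\<close> in the complete graph on \<open>n\<close> vertices, one may choose
  the \<open>s\<close> spine lengths and two intervals of leaf lengths freely, provided that all of them are at most
  \<open>n/2\<close> and that the sum of the spine lengths plus the two largest leaf lengths is less than \<open>n\<close>.
  With \<open>m = e(G)\<close>, let \<open>p \<le> q\<close> be the numbers of leaves at the two ends, so that \<open>m = s + p + q\<close>, and
  split \<open>{1..mk}\<close>, where \<open>mk\<close> is almost \<open>n/2\<close>, into \<open>k\<close> length sets. Each uses one length from
  each of the \<open>s\<close> shortest ranges of \<open>k\<close> lengths, of total at most \<open>k s (s + 1) / 2\<close>. Pairing the
  blocks of size \<open>p\<close> in ascending order with those of size \<open>q\<close> in descending order keeps the sum of
  the two largest leaf lengths at most \<open>(s + m) k + p\<close>. The total is at most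
  \<open>(s (s + 3) / 2 + m) k + p \<le> 2 m k + p\<close>, which is the only use of \<open>s (s + 3) \<le> 2 e(G)\<close>.\<close>

subsection \<open>Cyclic order and lengths\<close>

lemma crossing_segments:
  assumes "clockwise a b c" "clockwise a b d" "clockwise a c d" "clockwise b c d"
  shows "open_segment a c \<inter> open_segment b d \<noteq> {}"
proof -
  define D where "D a b c =
    (b $ 1 - a $ 1) * (c $ 2 - a $ 2) - (b $ 2 - a $ 2) * (c $ 1 - a $ 1)" for a b c :: "real^2"
  have neg: "D a b c < 0" "D a b d < 0" "D a c d < 0" "D b c d < 0"
    using assms by (simp_all add: clockwise_def D_def)
  define T where "T = D b c d + D a b d"
  have T: "T < 0" "T = D a c d + D a b c"
    using neg by (simp_all add: T_def) (simp add: D_def algebra_simps)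
  define z where "z = (1 - D a b d / T) *\<^sub>R a + (D a b d / T) *\<^sub>R c"
  have aff: "D b c d * a $ i + D a b d * c $ i = D a c d * b $ i + D a b c * d $ i" for i
  proof (cases "i = 1")
    case False
    then have "i = 2" using exhaust_2 by blast
    then show ?thesis by (simp add: D_def algebra_simps)
  qed (simp add: D_def algebra_simps)
  have "a \<noteq> c" "b \<noteq> d"
    using assms by (auto simp: clockwise_def)
  have w1: "1 - D a b d / T = D b c d / T"
    using T(1) by (simp add: T_def field_simps)
  have w2: "1 - D a b c / T = D a c d / T"
    using T by (simp add: field_simps)
  have "z = (1 - D a b c / T) *\<^sub>R b + (D a b c / T) *\<^sub>R d"
    unfolding z_def w1 w2 vec_eq_iff
    using aff T(1) by (simp add: add_divide_distrib[symmetric])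
  moreover have "0 < D a b d / T" "D a b d / T < 1" "0 < D a b c / T" "D a b c / T < 1"
    using neg T(1) T_def T(2) by (simp_all add: zero_less_divide_iff divide_less_eq)
  ultimately have "z \<in> open_segment a c" "z \<in> open_segment b d"
    using \<open>a \<noteq> c\<close> \<open>b \<noteq> d\<close> unfolding in_segment z_def by blast+
  then show ?thesis by blast
qed

lemma clockwise_rotate: "clockwise a b c \<Longrightarrow> clockwise b c a"
  by (simp add: clockwise_def algebra_simps)

lemma clockwise_listing_rotate1:
  assumes "clockwise_listing us"
  shows "clockwise_listing (rotate1 us)"
proof (cases us)
  case (Cons x xs)
  have cw: "clockwise ((x # xs) ! i) ((x # xs) ! j) ((x # xs) ! k)"
    if "i < j" "j < k" "k < Suc (length xs)" for i j k
    using assms that unfolding Cons clockwise_listing_def by simp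
  have "clockwise ((xs @ [x]) ! i) ((xs @ [x]) ! j) ((xs @ [x]) ! k)"
    if "i < j" "j < k" "k < Suc (length xs)" for i j k
  proof (cases "k = length xs")
    case True
    then show ?thesis
      using that cw[of 0 "Suc i" "Suc j"] by (simp add: nth_append clockwise_rotate)
  next
    case False
    then show ?thesis
      using that cw[of "Suc i" "Suc j" "Suc k"] by (simp add: nth_append)
  qed
  moreover have "distinct (rotate1 us)"
    using assms by (simp add: clockwise_listing_def)
  ultimately show ?thesis
    unfolding clockwise_listing_def Cons by simp
qed (use assms in simp)

lemma clockwise_listing_rotate: "clockwise_listing us \<Longrightarrow> clockwise_listing (rotate r us)"
  by (induction r) (simp_all add: clockwise_listing_rotate1)

definition cyclic_enum :: "cgg \<Rightarrow> nat \<Rightarrow> (nat \<Rightarrow> real^2) \<Rightarrow> bool" where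
  "cyclic_enum G N w \<longleftrightarrow> inj_on w {..<N} \<and> verts G = w ` {..<N} \<and>
     (\<forall>x y. cw_next G x y \<longleftrightarrow> (\<exists>i<N. x = w i \<and> y = w (Suc i mod N)))"

lemma cyclic_enum_rotate:
  assumes "distinct (vlist G)"
  shows "cyclic_enum G (length (vlist G)) ((!) (rotate r (vlist G)))"
proof -
  define us where "us = vlist G"
  define N where "N = length us"
  have nth: "rotate r us ! i = us ! ((r + i) mod N)" if "i < N" for i
    using that nth_rotate by (simp add: N_def)
  have "(\<exists>i<N. x = us ! i \<and> y = us ! (Suc i mod N)) \<longleftrightarrow>
      (\<exists>i<N. x = rotate r us ! i \<and> y = rotate r us ! (Suc i mod N))" (is "?L \<longleftrightarrow> ?R") for x y
  proof
    assume ?R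
    then obtain i where i: "i < N" "x = us ! ((r + i) mod N)" "y = us ! ((r + Suc i mod N) mod N)"
      using nth by auto
    moreover have "(r + Suc i mod N) mod N = Suc ((r + i) mod N) mod N"
      by (simp add: mod_simps)
    ultimately show ?L
      by (intro exI[of _ "(r + i) mod N"]) auto
  next
    assume ?L
    then obtain i where i: "i < N" "x = us ! i" "y = us ! (Suc i mod N)" by blast
    define j where "j = (i + (N - r mod N)) mod N"
    have "j < N" using i by (simp add: j_def)
    have "(r + j) mod N = (r mod N + (i + (N - r mod N))) mod N"
      by (simp add: j_def mod_simps)
    also have "\<dots> = i"
    proof -
      have "r mod N < N" using i(1) by simp
      then have "r mod N + (i + (N - r mod N)) = i + N" by simp
      then show ?thesis using i(1) by simp
    qed
    finally have rj: "(r + j) mod N = i" .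
    have "(r + Suc j mod N) mod N = Suc ((r + j) mod N) mod N"
      by (simp add: mod_simps)
    with rj have "(r + Suc j mod N) mod N = Suc i mod N" by simp
    then show ?R
      using i nth[of j] nth[of "Suc j mod N"] rj \<open>j < N\<close> by (intro exI[of _ j]) auto
  qed
  moreover have "inj_on ((!) (rotate r us)) {..<N}"
    using assms by (auto simp: us_def N_def inj_on_def nth_eq_iff_index_eq)
  moreover have "set us = ((!) (rotate r us)) ` {..<N}"
    by (metis N_def length_rotate lessThan_atLeast0 list.set_map map_nth set_rotate set_upt)
  ultimately show ?thesis
    by (simp add: cyclic_enum_def verts_def cw_next_def us_def N_def)
qed

definition circ_dist :: "nat \<Rightarrow> nat \<Rightarrow> nat \<Rightarrow> nat" where
  "circ_dist N i j = (if i \<le> j then min (j - i) (N - (j - i)) else min (i - j) (N - (i - j)))"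

lemma circ_dist_commute: "circ_dist N i j = circ_dist N j i"
  by (auto simp: circ_dist_def)

lemma extremal_pair_cyclic_enum:
  assumes "cyclic_enum G N w" "i < N" "j < N"
  shows "extremal_pair G (w i) (w j) \<longleftrightarrow> i \<noteq> j \<and> (j = Suc i mod N \<or> i = Suc j mod N)"
proof -
  have inj: "inj_on w {..<N}" using assms by (simp add: cyclic_enum_def)
  have eq: "w x = w y \<longleftrightarrow> x = y" if "x < N" "y < N" for x y
    using inj that by (auto simp: inj_on_def)
  have "cw_next G (w x) (w y) \<longleftrightarrow> y = Suc x mod N" if "x < N" "y < N" for x y
  proof -
    have "cw_next G (w x) (w y) \<longleftrightarrow> (\<exists>i<N. w x = w i \<and> w y = w (Suc i mod N))"
      using assms(1) by (simp add: cyclic_enum_def)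
    also have "\<dots> \<longleftrightarrow> y = Suc x mod N"
      using that eq by (metis mod_less_divisor not_less_zero gr0I)
    finally show ?thesis .
  qed
  then show ?thesis
    using assms eq by (auto simp: extremal_pair_def)
qed

definition extremal_path :: "cgg \<Rightarrow> (real^2) list \<Rightarrow> bool" where
  "extremal_path G p \<longleftrightarrow> distinct p \<and> (\<forall>i. Suc i < length p \<longrightarrow> extremal_pair G (p ! i) (p ! Suc i))"

lemma extremal_path_rev:
  assumes "extremal_path G p"
  shows "extremal_path G (rev p)"
proof -
  have "extremal_pair G (rev p ! i) (rev p ! Suc i)" if "Suc i < length p" for i
  proof -
    define j where "j = length p - Suc (Suc i)"
    have "rev p ! i = p ! Suc j" "rev p ! Suc i = p ! j" "Suc j < length p"
      using that by (simp_all add: rev_nth j_def Suc_diff_Suc)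
    then show ?thesis
      using assms by (auto simp: extremal_path_def extremal_pair_def)
  qed
  then show ?thesis
    using assms by (simp add: extremal_path_def)
qed

lemma extremal_path_exists:
  assumes "cyclic_enum G N w" "i \<le> j" "j < N"
  shows "\<exists>p. extremal_path G p \<and> length p = Suc (circ_dist N i j) \<and> hd p = w i \<and> last p = w j"
proof (cases "j - i \<le> N - (j - i)")
  case True
  have ep: "extremal_pair G (w (i + l)) (w (Suc (i + l)))" if "Suc (i + l) \<le> j" for l
    using extremal_pair_cyclic_enum[OF assms(1), of "i + l" "Suc (i + l)"] assms that by simp
  have "inj_on w {i..<Suc j}"
    using assms by (auto simp: cyclic_enum_def inj_on_def)
  then have "extremal_path G (map w [i..<Suc j])"
    using ep assms by (auto simp: extremal_path_def distinct_map simp del: upt_Suc)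
  then show ?thesis
    using True assms
    by (intro exI[of _ "map w [i..<Suc j]"])
      (auto simp: circ_dist_def hd_map last_map min_def simp del: upt_Suc simp: upt_conv_Cons[of i])
next
  case False
  define q where "q = rev [0..<Suc i] @ rev [j..<N]"
  have q: "distinct q" "length q = Suc i + (N - j)"
    "set q \<subseteq> {..<N}"
    using assms False by (auto simp: q_def simp del: upt_Suc)
  have nth: "q ! l = (if l \<le> i then i - l else N - (l - i))" if "l < length q" for l
    using that assms unfolding q_def
    by (auto simp: nth_append rev_nth simp del: upt_Suc)
  have ep: "extremal_pair G (w (q ! l)) (w (q ! Suc l))" if "Suc l < length q" for l
  proof -
    have "q ! l < N" "q ! Suc l < N" using q that by (meson Suc_lessD lessThan_iff nth_mem subsetD)+
    moreover have "q ! l \<noteq> q ! Suc l" using q(1) that by (simp add: nth_eq_iff_index_eq)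
    moreover have "q ! l = Suc (q ! Suc l) mod N"
    proof -
      consider "Suc l \<le> i" | "l = i" | "i < l" by linarith
      then show ?thesis
        using nth[of l] nth[of "Suc l"] that assms q(2)
        by cases (auto simp: Suc_diff_le)
    qed
    ultimately show ?thesis
      using extremal_pair_cyclic_enum[OF assms(1)] by blast
  qed
  have "inj_on w (set q)"
    using assms q(3) by (auto simp: cyclic_enum_def intro: inj_on_subset)
  then have "extremal_path G (map w q)"
    using ep q by (auto simp: extremal_path_def distinct_map)
  moreover have "hd (map w q) = w i" "last (map w q) = w j"
    using assms by (simp_all add: q_def last_rev upt_conv_Cons[of j])
  moreover have "length q = Suc (circ_dist N i j)"
    using q(2) False assms by (simp add: circ_dist_def min_def)
  ultimately show ?thesis
    by (intro exI[of _ "map w q"]) simp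
qed

lemma circ_dist_le_path_length:
  assumes "cyclic_enum G N w" "i < N" "j < N"
    and p: "length p = Suc k" "hd p = w i" "last p = w j"
      "\<forall>l<k. extremal_pair G (p ! l) (p ! Suc l)"
  shows "circ_dist N i j \<le> k"
proof -
  have inv: "\<exists>x<N. p ! l = w x \<and> circ_dist N i x \<le> l" if "l \<le> k" for l
    using that
  proof (induction l)
    case 0
    then show ?case
      using p assms by (intro exI[of _ i]) (cases p; auto simp: circ_dist_def)
  next
    case (Suc l)
    then obtain x where x: "x < N" "p ! l = w x" "circ_dist N i x \<le> l" by auto
    have e: "extremal_pair G (w x) (p ! Suc l)" using x(2)[symmetric] p(4) Suc.prems by simp
    then have "p ! Suc l \<in> w ` {..<N}"
      using assms(1) by (auto simp: extremal_pair_def cyclic_enum_def)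
    then obtain y where y: "y < N" "p ! Suc l = w y" by auto
    have "y = Suc x mod N \<or> x = Suc y mod N"
      using e extremal_pair_cyclic_enum[OF assms(1) x(1) y(1)] y by simp
    then have "circ_dist N i y \<le> Suc (circ_dist N i x)"
      using x(1) y(1) assms(2)
      by (auto simp: circ_dist_def mod_Suc split: if_splits)
    then show ?case using x y by auto
  qed
  obtain x where "x < N" "p ! k = w x" "circ_dist N i x \<le> k"
    using inv[of k] by auto
  moreover have "p ! k = w j" using p by (metis diff_Suc_1 last_conv_nth length_0_conv nat.distinct(1))
  ultimately show ?thesis
    using assms by (auto simp: cyclic_enum_def inj_on_def)
qed

lemma pair_length_cyclic_enum:
  assumes "cyclic_enum G N w" "i < N" "j < N"
  shows "pair_length G (w i) (w j) = circ_dist N i j"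
proof -
  obtain p where p: "extremal_path G p" "length p = Suc (circ_dist N i j)" "hd p = w i" "last p = w j"
  proof (cases "i \<le> j")
    case True
    then show ?thesis using extremal_path_exists[of G N w i j] assms that by blast
  next
    case False
    then obtain p where "extremal_path G p" "length p = Suc (circ_dist N j i)" "hd p = w j" "last p = w i"
      using extremal_path_exists[of G N w j i] assms by auto
    moreover from this have "p \<noteq> []" by auto
    ultimately show ?thesis
      using that[of "rev p"] circ_dist_commute
      by (simp add: extremal_path_rev hd_rev last_rev)
  qed
  show ?thesis
    unfolding pair_length_def
  proof (rule Least_equality)
    show "\<exists>p. length p = Suc (circ_dist N i j) \<and> distinct p \<and> hd p = w i \<and> last p = w j \<and>
        (\<forall>l<circ_dist N i j. extremal_pair G (p ! l) (p ! Suc l))"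
      using p by (intro exI[of _ p]) (auto simp: extremal_path_def)
  next
    fix k
    assume "\<exists>p. length p = Suc k \<and> distinct p \<and> hd p = w i \<and> last p = w j \<and>
        (\<forall>l<k. extremal_pair G (p ! l) (p ! Suc l))"
    then show "circ_dist N i j \<le> k"
      using circ_dist_le_path_length[OF assms] by blast
  qed
qed

subsection \<open>Structure of the caterpillar\<close>

lemma convex_isomorphic_cyclic_enum:
  assumes G: "cyclic_enum G N w" "edges G = (`) w ` E"
    and H: "cyclic_enum H N u" "edges H = (`) u ` E"
    and E: "E \<subseteq> Pow {..<N}"
  shows "convex_isomorphic H G"
proof -
  define f where "f = w \<circ> inv_into {..<N} u"
  have inj: "inj_on w {..<N}" "inj_on u {..<N}" and verts: "verts G = w ` {..<N}" "verts H = u ` {..<N}"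
    using G H by (simp_all add: cyclic_enum_def)
  have f: "f (u i) = w i" if "i < N" for i
    using inj that by (simp add: f_def)
  have edge: "{z i, z j} \<in> (`) z ` E \<longleftrightarrow> {i, j} \<in> E"
    if "inj_on z {..<N}" "i < N" "j < N" for z :: "nat \<Rightarrow> real^2" and i j
  proof -
    have "z ` {i, j} \<in> (`) z ` E \<longleftrightarrow> {i, j} \<in> E"
      by (rule inj_on_image_mem_iff[of _ "Pow {..<N}"])
        (use that E in \<open>auto intro: inj_on_image_Pow\<close>)
    then show ?thesis by simp
  qed
  have "bij_betw (inv_into {..<N} u) (verts H) {..<N}"
    using inj verts by (metis bij_betw_imageI bij_betw_inv_into)
  moreover have "bij_betw w {..<N} (verts G)"
    using inj verts by (simp add: bij_betw_imageI)
  ultimately have "bij_betw f (verts H) (verts G)"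
    unfolding f_def by (rule bij_betw_trans)
  moreover have "pair_length H x y = pair_length G (f x) (f y) \<and>
      ({x, y} \<in> edges H \<longleftrightarrow> {f x, f y} \<in> edges G)" if xy: "x \<in> verts H" "y \<in> verts H" for x y
  proof -
    obtain i j where ij: "i < N" "j < N" "x = u i" "y = u j"
      using xy unfolding verts(2) by blast
    show ?thesis
      unfolding ij(3,4) f[OF ij(1)] f[OF ij(2)] G(2) H(2)
      by (simp only: pair_length_cyclic_enum[OF G(1) ij(1,2)] pair_length_cyclic_enum[OF H(1) ij(1,2)]
        edge[OF inj(1) ij(1,2)] edge[OF inj(2) ij(1,2)] simp_thms)
  qed
  ultimately show ?thesis
    unfolding convex_isomorphic_def by blast
qed

text \<open>In the cyclic enumeration starting at the first spine vertex, vertex \<open>j \<ge> 1\<close> is joined to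
  exactly one vertex with a smaller index, its parent.\<close>

definition parent :: "nat \<Rightarrow> nat \<Rightarrow> nat \<Rightarrow> nat" where
  "parent s b j = (if j \<le> s then j - 1 else if j \<le> s + b then s else 0)"

lemma parent_less: "j \<ge> 1 \<Longrightarrow> parent s b j < j"
  by (auto simp: parent_def)

definition parent_edges :: "nat \<Rightarrow> nat \<Rightarrow> nat \<Rightarrow> nat set set" where
  "parent_edges s b N = (\<lambda>j. {parent s b j, j}) ` {1..<N}"

lemma parent_edges_subset: "parent_edges s b N \<subseteq> Pow {..<N}"
proof -
  have "{parent s b j, j} \<subseteq> {..<N}" if "j \<in> {1..<N}" for j
    using that parent_less[of j s b] by auto
  then show ?thesis by (auto simp: parent_edges_def)
qed

lemma card_parent_edges: "card (parent_edges s b N) = N - 1"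
proof -
  have "inj_on (\<lambda>j. {parent s b j, j}) {1..<N}"
  proof (rule inj_onI)
    fix i j
    assume "i \<in> {1..<N}" "j \<in> {1..<N}" "{parent s b i, i} = {parent s b j, j}"
    then show "i = j"
      using parent_less[of i s b] parent_less[of j s b] by (auto simp: doubleton_eq_iff)
  qed
  then show ?thesis
    by (simp add: parent_edges_def card_image)
qed

lemma leaf_neighbour_not_leaf:
  assumes "connected_graph G" "{x, y} \<in> edges G" "leaf G x" "leaf G y"
    and z: "z \<in> verts G" "\<not> leaf G z"
  shows False
proof -
  have single: "e = {x, y}" if e: "e \<in> edges G" "u \<in> e" and u: "u = x \<or> u = y" for e u
  proof -
    have "leaf G u" using assms u by auto
    then obtain e' where e': "{e \<in> edges G. u \<in> e} = {e'}"
      unfolding leaf_def using card_1_singletonE by blast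
    have "{x, y} \<in> {e \<in> edges G. u \<in> e}" "e \<in> {e \<in> edges G. u \<in> e}"
      using assms e u by auto
    then show ?thesis unfolding e' by simp
  qed
  have "(x, z) \<in> {(a, b). {a, b} \<in> edges G}\<^sup>*"
    using assms by (auto simp: connected_graph_def leaf_def)
  then have "z = x \<or> z = y"
  proof induction
    case (step c d)
    then have "{c, d} = {x, y}" using single[of "{c, d}" c] by auto
    then show ?case by blast
  qed simp
  then show False using assms by blast
qed

lemma caterpillar_structure:
  assumes "s \<ge> 1" "plane_convex_caterpillar G" "clockwise_spine G s v"
    and inner: "\<forall>i\<in>{2..s}. \<forall>x. leaf G x \<longrightarrow> {v i, x} \<notin> edges G"
  obtains N w b where "cyclic_enum G N w" "s + b < N" "edges G = (`) w ` parent_edges s b N"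
proof -
  have cgg: "is_cgg G" and plane: "plane G" and conn: "connected_graph G"
    using assms(2) unfolding plane_convex_caterpillar_def tree_def by blast+
  have edge_verts: "\<exists>y\<in>verts G. x \<noteq> y \<and> e = {x, y}" if e: "e \<in> edges G" "x \<in> e" for e x
  proof -
    obtain a c where "a \<in> verts G" "c \<in> verts G" "a \<noteq> c" "e = {a, c}"
      using cgg e(1) unfolding is_cgg_def by blast
    then show ?thesis using e(2) by auto
  qed
  define N where "N = length (vlist G)"
  have dist: "distinct (vlist G)"
    using cgg by (simp add: is_cgg_def clockwise_listing_def)
  have "verts (delete_leaves G) = {x \<in> verts G. \<not> leaf G x}"
    by (auto simp: verts_def delete_leaves_def)
  moreover have "edges (delete_leaves G) = {e \<in> edges G. \<forall>x\<in>e. \<not> leaf G x}"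
    by (simp add: delete_leaves_def)
  ultimately have v: "bij_betw v {1..s+1} {x \<in> verts G. \<not> leaf G x}"
    and spine: "{e \<in> edges G. \<forall>x\<in>e. \<not> leaf G x} = {{v i, v (i + 1)} |i. i \<in> {1..s}}"
    and next_v: "\<And>i. i \<in> {1..s} \<Longrightarrow> cw_next G (v i) (v (i + 1))"
    using assms(3) unfolding clockwise_spine_def traverses_def by metis+
  have v_nonleaf: "v i \<in> verts G" "\<not> leaf G (v i)" if "i \<in> {1..s+1}" for i
    using v that by (auto simp: bij_betw_def)
  have "s + 1 \<le> card (verts G)"
  proof -
    have "card {1..s+1} \<le> card (verts G)"
      by (rule card_inj_on_le[of v]) (use v v_nonleaf in \<open>auto simp: bij_betw_def verts_def\<close>)
    then show ?thesis by simp
  qed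
  then have sN: "s < N"
    using dist by (simp add: N_def verts_def distinct_card)
  obtain r where r: "r < N" "v 1 = vlist G ! r"
    using v_nonleaf(1)[of 1] by (auto simp: verts_def N_def in_set_conv_nth)
  define w where "w = (!) (rotate r (vlist G))"
  have ce: "cyclic_enum G N w"
    unfolding w_def N_def by (rule cyclic_enum_rotate[OF dist])
  have w_eq: "w i = w j \<longleftrightarrow> i = j" if "i < N" "j < N" for i j
    using ce that by (auto simp: cyclic_enum_def inj_on_def)
  have verts: "verts G = w ` {..<N}"
    using ce by (simp add: cyclic_enum_def)
  have v_w: "v (Suc i) = w i" if "i \<le> s" for i
    using that
  proof (induction i)
    case 0
    have "rotate r (vlist G) ! 0 = vlist G ! ((r + 0) mod length (vlist G))"
      by (rule nth_rotate) (use sN in \<open>simp add: N_def[symmetric]\<close>)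
    then show ?case using r by (simp add: w_def N_def)
  next
    case (Suc i)
    then have "cw_next G (w i) (v (Suc (Suc i)))"
      using next_v[of "Suc i"] by simp
    then obtain j where "j < N" "w i = w j" "v (Suc (Suc i)) = w (Suc j mod N)"
      using ce by (auto simp: cyclic_enum_def)
    then show ?case using w_eq Suc.prems sN by simp
  qed
  have nonleaf: "\<exists>i\<le>s. x = w i" if "x \<in> verts G" "\<not> leaf G x" for x
  proof -
    have "x \<in> v ` {1..s+1}" using v that by (auto simp: bij_betw_def)
    then obtain i where "i \<in> {1..s+1}" "x = v i" by blast
    then show ?thesis using v_w[of "i - 1"] by (intro exI[of _ "i - 1"]) auto
  qed
  have leaf_w: "leaf G (w j)" if "s < j" "j < N" for j
    using nonleaf[of "w j"] that w_eq sN verts by fastforce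
  have leaf_edge: "\<exists>y\<in>{w 0, w s}. {e \<in> edges G. w j \<in> e} = {{y, w j}}" if j: "s < j" "j < N" for j
  proof -
    obtain e where e: "{e \<in> edges G. w j \<in> e} = {e}"
      using leaf_w[OF j] unfolding leaf_def using card_1_singletonE by blast
    then have "e \<in> edges G" "w j \<in> e" by auto
    then obtain y where y: "y \<in> verts G" "e = {w j, y}" using edge_verts by blast
    have "\<not> leaf G y"
      using leaf_neighbour_not_leaf[OF conn, of "w j" y "v 1"] leaf_w[OF j] \<open>e \<in> edges G\<close> y v_nonleaf[of 1]
      by auto
    then obtain i where i: "i \<le> s" "y = w i" using nonleaf y by blast
    have "{v (Suc i), w j} \<in> edges G"
      using \<open>e \<in> edges G\<close> y i v_w by (simp add: insert_commute)
    then have "Suc i \<notin> {2..s}" using inner leaf_w[OF j] by blast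
    then have "i = 0 \<or> i = s" using i by auto
    then show ?thesis using e y i by (auto simp: insert_commute)
  qed
  define B where "B = {j \<in> {s<..<N}. {w s, w j} \<in> edges G}"
  have cl: "clockwise_listing (rotate r (vlist G))"
    using cgg by (simp add: is_cgg_def clockwise_listing_rotate)
  have down: "i \<in> B" if "j \<in> B" "s < i" "i < j" for i j
  proof (rule ccontr)
    assume "i \<notin> B"
    then have "{w 0, w i} \<in> edges G"
      using leaf_edge[of i] that by (auto simp: B_def)
    moreover have "{w s, w j} \<in> edges G" "j < N" using that by (auto simp: B_def)
    moreover have "{w 0, w i} \<noteq> {w s, w j}"
      using w_eq that \<open>j < N\<close> by (auto simp: doubleton_eq_iff)
    ultimately have "open_segment (w 0) (w i) \<inter> open_segment (w s) (w j) = {}"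
      using plane by (simp add: plane_def)
    moreover have "clockwise (w 0) (w s) (w i)" "clockwise (w 0) (w s) (w j)"
        "clockwise (w 0) (w i) (w j)" "clockwise (w s) (w i) (w j)"
      using cl that \<open>j < N\<close> \<open>s \<ge> 1\<close> by (auto simp: clockwise_listing_def w_def N_def)
    ultimately show False using crossing_segments by blast
  qed
  obtain b where b: "s + b < N" "B = {s<..s + b}"
  proof (cases "B = {}")
    case True
    then show ?thesis using that[of 0] sN by simp
  next
    case False
    have "finite B" by (auto simp: B_def)
    define M where "M = Max B"
    have M: "M \<in> B" "\<And>j. j \<in> B \<Longrightarrow> j \<le> M"
      using \<open>finite B\<close> False by (auto simp: M_def)
    then have "s < M" "M < N" by (auto simp: B_def)
    moreover have "B = {s<..M}"
    proof
      show "B \<subseteq> {s<..M}" using M(2) by (auto simp: B_def)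
      show "{s<..M} \<subseteq> B" using down[OF M(1)] M(1) by (auto simp: le_less)
    qed
    ultimately show ?thesis using that[of "M - s"] by simp
  qed
  have leaf_parent: "{e \<in> edges G. w j \<in> e} = {{w (parent s b j), w j}}" if j: "s < j" "j < N" for j
  proof -
    obtain y where y: "y = w 0 \<or> y = w s" and e: "{e \<in> edges G. w j \<in> e} = {{y, w j}}"
      using leaf_edge[OF j] by blast
    show ?thesis
    proof (cases "j \<in> B")
      case True
      then have "{w s, w j} \<in> {e \<in> edges G. w j \<in> e}" by (auto simp: B_def)
      then have "{w s, w j} = {y, w j}" unfolding e by (rule singletonD)
      then show ?thesis using True b(2) j unfolding e by (simp add: parent_def)
    next
      case False
      then have "{w s, w j} \<notin> {e \<in> edges G. w j \<in> e}" using j by (auto simp: B_def)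
      then have "y = w 0" using y unfolding e by blast
      then show ?thesis using False b(2) j unfolding e by (simp add: parent_def)
    qed
  qed
  have spine': "{w (parent s b j), w j} \<in> edges G" if "1 \<le> j" "j \<le> s" for j
  proof -
    have "{v j, v (j + 1)} \<in> {e \<in> edges G. \<forall>x\<in>e. \<not> leaf G x}"
      unfolding spine using that by auto
    then show ?thesis using that v_w[of j] v_w[of "j - 1"] by (simp add: parent_def)
  qed
  have img: "(`) w ` parent_edges s b N = (\<lambda>j. {w (parent s b j), w j}) ` {1..<N}"
    by (simp add: parent_edges_def image_image)
  have "edges G = (`) w ` parent_edges s b N"
    unfolding img
  proof (intro equalityI subsetI)
    fix e assume "e \<in> (\<lambda>j. {w (parent s b j), w j}) ` {1..<N}"
    then obtain j where j: "1 \<le> j" "j < N" "e = {w (parent s b j), w j}" by auto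
    then show "e \<in> edges G"
      using spine'[of j] leaf_parent[of j] by (cases "j \<le> s") auto
  next
    fix e assume e: "e \<in> edges G"
    show "e \<in> (\<lambda>j. {w (parent s b j), w j}) ` {1..<N}"
    proof (cases "\<forall>x\<in>e. \<not> leaf G x")
      case True
      then have "e \<in> {{v i, v (i + 1)} |i. i \<in> {1..s}}"
        using e unfolding spine[symmetric] by simp
      then obtain i where i: "i \<in> {1..s}" "e = {v i, v (i + 1)}" by blast
      moreover from this obtain j where "i = Suc j" by (cases i) auto
      ultimately have "e = {w (parent s b i), w i}"
        using v_w[of i] v_w[of j] by (simp add: parent_def)
      then show ?thesis using i sN by auto
    next
      case False
      then obtain x where x: "x \<in> e" "leaf G x" by blast
      then obtain j where j: "j < N" "x = w j" using verts by (auto simp: leaf_def)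
      have "s < j"
        using v_nonleaf(2)[of "Suc j"] v_w[of j] x j by (cases "j \<le> s") auto
      then have "e = {w (parent s b j), w j}"
        using leaf_parent[of j] e x j by auto
      then show ?thesis using j \<open>s < j\<close> by auto
    qed
  qed
  then show ?thesis using that ce b(1) by blast
qed

subsection \<open>Packing the length sets\<close>

lemma caterpillar_embedding:
  fixes s a b n \<alpha> \<beta> :: nat and g :: "nat \<Rightarrow> nat"
  assumes G: "cyclic_enum G N w" "edges G = (`) w ` parent_edges s b N" and N: "N = Suc (s + b + a)"
    and K: "complete_cgg n K" and "s \<ge> 1"
    and g: "\<And>i. i \<in> {1..s} \<Longrightarrow> 1 \<le> g i \<and> g i \<le> n div 2"
    and half: "\<beta> + b \<le> n div 2" "\<alpha> + a \<le> n div 2"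
    and room: "(\<Sum>i=1..s. g i) + (\<beta> + b) + (\<alpha> + a) < n"
  shows "\<exists>H. cgg_subgraph H K \<and> convex_isomorphic H G \<and>
    length_set K H = g ` {1..s} \<union> {\<beta><..\<beta> + b} \<union> {\<alpha><..\<alpha> + a}"
proof -
  define P where "P j = (\<Sum>i=1..j. g i)" for j
  define p where "p j = (if j \<le> s then P j else if j \<le> s + b then P s + \<beta> + (j - s)
    else n - (\<alpha> + (N - j)))" for j
  have P_Suc: "P (Suc j) = P j + g (Suc j)" for j
    by (simp add: P_def)
  have P_le: "P j \<le> P s" if "j \<le> s" for j
    unfolding P_def using that by (intro sum_mono2) auto
  have room': "P s + (\<beta> + b) + (\<alpha> + a) < n"
    using room by (simp add: P_def)
  have p_step: "p j < p (Suc j)" if "Suc j < N" for j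
    using that g[of "Suc j"] room' P_le[of j] P_Suc[of j] N by (auto simp: p_def)
  have p_less: "p i < p j" if "i < j" "j < N" for i j
    using that
  proof (induction j)
    case (Suc j)
    then show ?case using p_step[of j] by (cases "i = j") (auto dest: Suc_lessD)
  qed simp
  have p_n: "p j < n" if "j < N" for j
    using that room' P_le[of j] N by (auto simp: p_def)
  define us where "us = vlist K"
  have Kcgg: "is_cgg K" and Kedges: "edges K = {{x, y} |x y. x \<in> verts K \<and> y \<in> verts K \<and> x \<noteq> y}"
    and Kcard: "card (verts K) = n"
    using K by (auto simp: complete_cgg_def)
  have cl: "clockwise_listing us" and "distinct us"
    using Kcgg by (auto simp: is_cgg_def clockwise_listing_def us_def)
  have len: "length us = n"
    using Kcard \<open>distinct us\<close> by (simp add: verts_def us_def distinct_card)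
  have ceK: "cyclic_enum K n ((!) us)"
    using cyclic_enum_rotate[of K 0] \<open>distinct us\<close> len by (simp add: us_def)
  define u where "u = (!) (map (\<lambda>j. us ! p j) [0..<N])"
  have u: "u j = us ! p j" if "j < N" for j
    using that by (simp add: u_def)
  define H where "H = \<lparr>vlist = map (\<lambda>j. us ! p j) [0..<N], edges = (`) u ` parent_edges s b N\<rparr>"
  have p_eq: "p i = p j \<longleftrightarrow> i = j" if "i < N" "j < N" for i j
    using p_less that by (metis linorder_neqE_nat less_irrefl)
  have distH: "distinct (vlist H)"
    using \<open>distinct us\<close> p_n len p_eq
    by (auto simp: H_def distinct_map inj_on_def nth_eq_iff_index_eq)
  have ceH: "cyclic_enum H N u"
    using cyclic_enum_rotate[OF distH, of 0] by (simp add: H_def u_def)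
  have vertsH: "verts H \<subseteq> verts K"
    using p_n len by (auto simp: verts_def H_def us_def[symmetric])
  have edgesH: "edges H = (\<lambda>j. {u (parent s b j), u j}) ` {1..<N}"
    by (simp add: H_def parent_edges_def image_image)
  have u_vert: "u j \<in> verts H" if "j < N" for j
    using ceH that by (auto simp: cyclic_enum_def)
  have u_neq: "u (parent s b j) \<noteq> u j" if "j \<in> {1..<N}" for j
  proof -
    have "parent s b j < j" "j < N" using that parent_less by auto
    moreover have "inj_on u {..<N}" using ceH by (simp add: cyclic_enum_def)
    ultimately show ?thesis using inj_onD[of u "{..<N}" "parent s b j" j] by auto
  qed
  have "is_cgg H"
    unfolding is_cgg_def
  proof (intro conjI ballI)
    show "strictly_convex_position (verts H)"
      unfolding strictly_convex_position_def
    proof (intro conjI ballI)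
      fix x assume "x \<in> verts H"
      then have "x \<notin> convex hull (verts K - {x})"
        using Kcgg vertsH by (auto simp: is_cgg_def strictly_convex_position_def)
      then show "x \<notin> convex hull (verts H - {x})"
        using hull_mono[of "verts H - {x}" "verts K - {x}"] vertsH by blast
    qed (simp add: verts_def)
    show "clockwise_listing (vlist H)"
      using distH cl p_less p_n len by (auto simp: clockwise_listing_def H_def)
    fix e assume "e \<in> edges H"
    then obtain j where j: "j \<in> {1..<N}" "e = {u (parent s b j), u j}"
      unfolding edgesH by blast
    then show "\<exists>x\<in>verts H. \<exists>y\<in>verts H. x \<noteq> y \<and> e = {x, y}"
      using u_neq[of j] u_vert[of j] u_vert[of "parent s b j"] parent_less[of j s b] by auto
  qed
  then have sub: "cgg_subgraph H K"
    using vertsH unfolding cgg_subgraph_def is_cgg_def Kedges by blast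
  have iso: "convex_isomorphic H G"
    by (rule convex_isomorphic_cyclic_enum[OF G ceH _ parent_edges_subset]) (simp add: H_def)
  define l where "l j = circ_dist n (p (parent s b j)) (p j)" for j
  have pl: "pair_length K (u i) (u j) = circ_dist n (p i) (p j)" if "i < N" "j < N" for i j
    using that u p_n pair_length_cyclic_enum[OF ceK, of "p i" "p j"] by simp
  have plj: "pair_length K (u (parent s b j)) (u j) = l j" "pair_length K (u j) (u (parent s b j)) = l j"
    if "j \<in> {1..<N}" for j
    using that parent_less[of j s b] pl[of "parent s b j" j] pl[of j "parent s b j"]
    by (auto simp: l_def circ_dist_commute)
  have "length_set K H = l ` {1..<N}"
  proof (intro equalityI subsetI)
    fix d assume "d \<in> length_set K H"
    then obtain x y j where "d = pair_length K x y" "j \<in> {1..<N}" "{x, y} = {u (parent s b j), u j}"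
      unfolding length_set_def edgesH by blast
    then show "d \<in> l ` {1..<N}"
      using plj[of j] by (auto simp: doubleton_eq_iff)
  next
    fix d assume "d \<in> l ` {1..<N}"
    then obtain j where "j \<in> {1..<N}" "d = l j" by blast
    moreover from this have "{u (parent s b j), u j} \<in> edges H"
      unfolding edgesH by blast
    ultimately show "d \<in> length_set K H"
      using plj(1)[of j] unfolding length_set_def by (intro CollectI exI conjI) auto
  qed
  also have "{1..<N} = {1..s} \<union> {s<..s + b} \<union> {s + b<..<N}"
    using N \<open>s \<ge> 1\<close> by auto
  also have "l ` \<dots> = l ` {1..s} \<union> l ` {s<..s + b} \<union> l ` {s + b<..<N}"
    by (simp add: image_Un)
  also have "l ` {1..s} = g ` {1..s}"
  proof (rule image_cong)
    fix j assume j: "j \<in> {1..s}"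
    then have "p j = p (j - 1) + g j"
      using P_Suc[of "j - 1"] by (auto simp: p_def)
    then show "l j = g j"
      using j g[OF j] by (auto simp: l_def parent_def circ_dist_def)
  qed simp
  also have "l ` {s<..s + b} = (\<lambda>j. \<beta> + (j - s)) ` {s<..s + b}"
    using half by (intro image_cong) (auto simp: l_def parent_def circ_dist_def p_def)
  also have "\<dots> = {\<beta><..\<beta> + b}"
  proof (intro equalityI subsetI)
    fix x assume "x \<in> {\<beta><..\<beta> + b}"
    then show "x \<in> (\<lambda>j. \<beta> + (j - s)) ` {s<..s + b}"
      by (intro image_eqI[of _ _ "s + (x - \<beta>)"]) auto
  qed auto
  also have "l ` {s + b<..<N} = (\<lambda>j. \<alpha> + (N - j)) ` {s + b<..<N}"
  proof (rule image_cong)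
    fix j assume j: "j \<in> {s + b<..<N}"
    have "p 0 = 0" by (simp add: p_def P_def)
    moreover have "\<alpha> + (N - j) \<le> n div 2" using j half N by auto
    ultimately show "l j = \<alpha> + (N - j)"
      using j by (auto simp: l_def parent_def circ_dist_def p_def)
  qed simp
  also have "\<dots> = {\<alpha><..\<alpha> + a}"
  proof (intro equalityI subsetI)
    fix x assume "x \<in> {\<alpha><..\<alpha> + a}"
    then show "x \<in> (\<lambda>j. \<alpha> + (N - j)) ` {s + b<..<N}"
      using N by (intro image_eqI[of _ _ "N - (x - \<alpha>)"]) auto
  qed (use N in auto)
  finally show ?thesis using sub iso by blast
qed

text \<open>The caterpillar number \<open>t < k\<close> takes its spine from the columns \<open>{(i - 1) k <.. i k}\<close>,
  the smaller bundle of leaves (of size \<open>p\<close>) from the next \<open>p k\<close> lengths in ascending order,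
  and the larger bundle (of size \<open>q\<close>) from the last \<open>q k\<close> lengths in descending order.\<close>

definition packing_set :: "nat \<Rightarrow> nat \<Rightarrow> nat \<Rightarrow> nat \<Rightarrow> nat \<Rightarrow> nat set" where
  "packing_set s p q k t = (\<lambda>i. i * k - t) ` {1..s} \<union>
     {s * k + t * p<..s * k + t * p + p} \<union>
     {(s + p) * k + (k - 1 - t) * q<..(s + p) * k + (k - 1 - t) * q + q}"

lemma block_le: "t < k \<Longrightarrow> t * p + p \<le> k * (p::nat)"
  by (metis Suc_leI add.commute mult_Suc mult_le_mono1)

lemma column_bounds:
  fixes i k t s :: nat
  assumes "i \<in> {1..s}" "t < k"
  shows "1 \<le> i * k - t" "i * k - t \<le> s * k"
proof -
  have "k \<le> i * k" "i * k \<le> s * k" using assms by auto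
  then show "1 \<le> i * k - t" "i * k - t \<le> s * k" using assms by linarith+
qed

lemma packing_set_bounds:
  fixes s p q k t :: nat
  assumes "t < k"
  shows "(\<lambda>i. i * k - t) ` {1..s} \<subseteq> {1..s * k}"
    "{s * k + t * p<..s * k + t * p + p} \<subseteq> {s * k<..(s + p) * k}"
    "{(s + p) * k + (k - 1 - t) * q<..(s + p) * k + (k - 1 - t) * q + q}
      \<subseteq> {(s + p) * k<..(s + p + q) * k}"
proof -
  show "(\<lambda>i. i * k - t) ` {1..s} \<subseteq> {1..s * k}"
    using column_bounds[of _ s t k] assms by auto
  have "t * p + p \<le> k * p" "(k - 1 - t) * q + q \<le> k * q"
    using assms by (auto intro!: block_le)
  then show "{s * k + t * p<..s * k + t * p + p} \<subseteq> {s * k<..(s + p) * k}"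
    "{(s + p) * k + (k - 1 - t) * q<..(s + p) * k + (k - 1 - t) * q + q}
      \<subseteq> {(s + p) * k<..(s + p + q) * k}"
    by (auto simp: algebra_simps)
qed

lemma packing_set_subset:
  assumes "t < k"
  shows "packing_set s p q k t \<subseteq> {1..(s + p + q) * k}"
proof -
  have "s * k \<le> (s + p + q) * k" "(s + p) * k \<le> (s + p + q) * k" by simp_all
  then have "{1..s * k} \<subseteq> {1..(s + p + q) * k}" "{s * k<..(s + p) * k} \<subseteq> {1..(s + p + q) * k}"
    "{(s + p) * k<..(s + p + q) * k} \<subseteq> {1..(s + p + q) * k}"
    unfolding subset_iff greaterThanAtMost_iff atLeastAtMost_iff by linarith+
  then show ?thesis
    using packing_set_bounds(1)[OF assms, of s] packing_set_bounds(2)[OF assms, of s p]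
      packing_set_bounds(3)[OF assms, of s p q]
    unfolding packing_set_def by (meson Un_least subset_trans)
qed

lemma packing_set_locate:
  assumes "t < k" "x \<in> packing_set s p q k t"
  shows "x \<le> s * k \<Longrightarrow> x \<in> (\<lambda>i. i * k - t) ` {1..s}"
    "s * k < x \<Longrightarrow> x \<le> (s + p) * k \<Longrightarrow> x \<in> {s * k + t * p<..s * k + t * p + p}"
    "(s + p) * k < x \<Longrightarrow>
      x \<in> {(s + p) * k + (k - 1 - t) * q<..(s + p) * k + (k - 1 - t) * q + q}"
proof -
  define S P Q where "S = (\<lambda>i. i * k - t) ` {1..s}" and "P = {s * k + t * p<..s * k + t * p + p}"
    and "Q = {(s + p) * k + (k - 1 - t) * q<..(s + p) * k + (k - 1 - t) * q + q}"
  have mem: "x \<in> S \<or> x \<in> P \<or> x \<in> Q"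
    using assms(2) by (simp only: packing_set_def S_def P_def Q_def Un_iff disj_assoc)
  have S: "x \<le> s * k" if "x \<in> S"
    using subsetD[OF packing_set_bounds(1)[OF assms(1)] that[unfolded S_def]] by simp
  have P: "s * k < x \<and> x \<le> (s + p) * k" if "x \<in> P"
    using subsetD[OF packing_set_bounds(2)[OF assms(1)] that[unfolded P_def]]
    by (simp only: greaterThanAtMost_iff)
  have Q: "(s + p) * k < x" if "x \<in> Q"
    using subsetD[OF packing_set_bounds(3)[OF assms(1)] that[unfolded Q_def]]
    by (simp only: greaterThanAtMost_iff)
  have "s * k \<le> (s + p) * k" by simp
  with mem S P Q have locate: "x \<le> s * k \<Longrightarrow> x \<in> S" "s * k < x \<Longrightarrow> x \<le> (s + p) * k \<Longrightarrow> x \<in> P"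
    "(s + p) * k < x \<Longrightarrow> x \<in> Q"
    by (meson leD order_trans)+
  show "x \<le> s * k \<Longrightarrow> x \<in> (\<lambda>i. i * k - t) ` {1..s}"
    "s * k < x \<Longrightarrow> x \<le> (s + p) * k \<Longrightarrow> x \<in> {s * k + t * p<..s * k + t * p + p}"
    "(s + p) * k < x \<Longrightarrow>
      x \<in> {(s + p) * k + (k - 1 - t) * q<..(s + p) * k + (k - 1 - t) * q + q}"
    using locate by (simp_all only: S_def P_def Q_def)
qed

lemma card_packing_set:
  assumes "t < k"
  shows "card (packing_set s p q k t) = s + p + q"
proof -
  let ?S = "(\<lambda>i. i * k - t) ` {1..s}"
  let ?P = "{s * k + t * p<..s * k + t * p + p}"
  let ?Q = "{(s + p) * k + (k - 1 - t) * q<..(s + p) * k + (k - 1 - t) * q + q}"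
  note b = packing_set_bounds(1)[OF assms, of s] packing_set_bounds(2)[OF assms, of s p]
    packing_set_bounds(3)[OF assms, of s p q]
  have "inj_on (\<lambda>i. i * k - t) {1..s}"
  proof (rule inj_onI)
    fix i j assume ij: "i \<in> {1..s}" "j \<in> {1..s}" "i * k - t = j * k - t"
    then have "i * k = j * k"
      using column_bounds(1)[of i s t k] column_bounds(1)[of j s t k] assms by linarith
    then show "i = j" using assms by simp
  qed
  then have "card ?S = s" by (simp add: card_image)
  moreover have "?S \<inter> ?P = {}" using b(1,2) by fastforce
  moreover have "(?S \<union> ?P) \<inter> ?Q = {}"
  proof -
    have "?S \<union> ?P \<subseteq> {..(s + p) * k}" using b(1,2) by (fastforce simp: algebra_simps)
    then show ?thesis using b(3) by fastforce
  qed
  ultimately show ?thesis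
    unfolding packing_set_def by (subst card_Un_disjoint; (subst card_Un_disjoint)?) auto
qed

lemma block_index:
  fixes c x t p :: nat
  assumes "x \<in> {c + t * p<..c + t * p + p}"
  shows "(x - c - 1) div p = t"
proof -
  obtain r where "x - c - 1 = r + t * p" "r < p"
    using assms by (intro that[of "x - c - 1 - t * p"]) auto
  then show ?thesis by simp
qed

lemma disjoint_packing_sets:
  assumes "t < k" "t' < k" "t \<noteq> t'"
  shows "packing_set s p q k t \<inter> packing_set s p q k t' = {}"
proof (rule ccontr)
  assume "\<not> ?thesis"
  then obtain x where x: "x \<in> packing_set s p q k t" "x \<in> packing_set s p q k t'" by blast
  note locate = packing_set_locate[OF assms(1) x(1)] packing_set_locate[OF assms(2) x(2)]
  consider (S) "x \<le> s * k" | (P) "s * k < x" "x \<le> (s + p) * k" | (Q) "(s + p) * k < x"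
    by linarith
  then show False
  proof cases
    case S
    from locate(1)[OF S] locate(4)[OF S] obtain i j where ij: "i \<in> {1..s}" "x = i * k - t" "j \<in> {1..s}" "x = j * k - t'" by blast
    then have "i * k + t' = j * k + t"
      using column_bounds(1)[of i s t k] column_bounds(1)[of j s t' k] assms by linarith
    then have "(i * k + t') mod k = (j * k + t) mod k" by simp
    then show False using assms by simp
  next
    case P
    show False
      using block_index[OF locate(2)[OF P]] block_index[OF locate(5)[OF P]] assms(3) by simp
  next
    case Q
    have "k - 1 - t = k - 1 - t'"
      using block_index[OF locate(3)[OF Q]] block_index[OF locate(6)[OF Q]] by simp
    then show False using assms by linarith
  qed
qed

lemma packing_set_room:
  fixes s p q k t :: nat
  assumes "p \<le> q" "t < k" "s * (s + 3) \<le> 2 * (s + p + q)"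
  shows "(\<Sum>i=1..s. i * k - t) + (s * k + t * p + p) + ((s + p) * k + (k - 1 - t) * q + q)
    \<le> 2 * (s + p + q) * k + p"
proof -
  have "(\<Sum>i=1..s. i * k - t) \<le> (\<Sum>i=1..s. i * k)" by (intro sum_mono) simp
  also have "2 * \<dots> = s * (s + 1) * k"
    by (induction s) (simp_all add: algebra_simps)
  finally have "2 * (\<Sum>i=1..s. i * k - t) + 2 * (s * k) \<le> s * (s + 3) * k"
    by (simp add: algebra_simps)
  also have "\<dots> \<le> 2 * ((s + p + q) * k)"
    using mult_right_mono[OF assms(3), of k] by (simp only: mult.assoc)
  finally have 1: "(\<Sum>i=1..s. i * k - t) + s * k \<le> (s + p + q) * k"
    by linarith
  have "t * p + ((k - 1 - t) * q + q) \<le> t * q + ((k - 1 - t) * q + q)"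
    using assms(1) by simp
  also have "\<dots> = (t + (k - 1 - t) + 1) * q" by (simp add: algebra_simps)
  also have "\<dots> = k * q" using assms(2) by simp
  finally show ?thesis using 1 by (simp add: algebra_simps)
qed

lemma packing_set_embedding:
  assumes G: "cyclic_enum G N w" "edges G = (`) w ` parent_edges s b N" and N: "N = Suc (s + b + a)"
    and K: "complete_cgg n K" and s: "s \<ge> 1" "s * (s + 3) \<le> 2 * (s + b + a)"
    and t: "t < k" and n: "2 * (s + b + a) * k + (s + b + a) \<le> n"
  shows "\<exists>H. cgg_subgraph H K \<and> convex_isomorphic H G \<and>
    length_set K H = packing_set s (min a b) (max a b) k t"
proof -
  define p q where "p = min a b" and "q = max a b"
  have pq: "p \<le> q" "s + b + a = s + p + q" by (auto simp: p_def q_def min_def max_def)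
  define c d where "c = s * k + t * p" and "d = (s + p) * k + (k - 1 - t) * q"
  have "(\<Sum>i=1..s. i * k - t) + (c + p) + (d + q) \<le> 2 * (s + p + q) * k + p"
    using packing_set_room[OF pq(1) t] s unfolding c_def d_def pq(2) by simp
  also have "\<dots> < n" using n s unfolding pq(2) by linarith
  finally have room: "(\<Sum>i=1..s. i * k - t) + (c + p) + (d + q) < n" .
  have half: "(s + p + q) * k \<le> n div 2" using n unfolding pq(2) by linarith
  have "t * p + p \<le> k * p" "(k - 1 - t) * q + q \<le> k * q"
    using t by (auto intro!: block_le)
  then have "c + p \<le> (s + p + q) * k" "d + q \<le> (s + p + q) * k"
    by (simp_all add: c_def d_def algebra_simps)
  then have cd: "c + p \<le> n div 2" "d + q \<le> n div 2" using half by auto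
  have g: "1 \<le> i * k - t \<and> i * k - t \<le> n div 2" if "i \<in> {1..s}" for i
    using column_bounds[OF that t] half by (auto simp: algebra_simps)
  have ps: "packing_set s p q k t = (\<lambda>i. i * k - t) ` {1..s} \<union> {c<..c + p} \<union> {d<..d + q}"
    by (simp add: packing_set_def c_def d_def)
  show ?thesis
  proof (cases "b \<le> a")
    case True
    then have "p = b" "q = a" by (simp_all add: p_def q_def)
    then show ?thesis
      using caterpillar_embedding[OF G N K s(1) g, where \<beta> = c and \<alpha> = d] cd room ps p_def q_def by simp
  next
    case False
    then have "p = a" "q = b" by (simp_all add: p_def q_def)
    then show ?thesis
      using caterpillar_embedding[OF G N K s(1) g, where \<beta> = d and \<alpha> = c] cd room ps p_def q_def
      by (simp add: Un_ac)
  qed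
qed

lemma covered_fraction_smallo:
  fixes m :: nat
  assumes "m > 0"
  shows "(\<lambda>n. 1 - 2 * real (((n - m) div (2 * m)) * m) / real n) \<in> o(\<lambda>_. 1)"
proof (rule smalloI_tendsto)
  have bounds: "0 \<le> 1 - 2 * real (((n - m) div (2 * m)) * m) / real n \<and>
      1 - 2 * real (((n - m) div (2 * m)) * m) / real n \<le> 3 * real m / real n" if "n > 0" for n
  proof -
    define k where "k = (n - m) div (2 * m)"
    have "2 * m * k + (n - m) mod (2 * m) = n - m" "(n - m) mod (2 * m) < 2 * m"
      using assms by (simp_all add: k_def)
    then have "2 * (k * m) \<le> n" "n \<le> 2 * (k * m) + 3 * m"
      by (simp_all add: algebra_simps)
    then have "2 * real (k * m) \<le> real n" "real n \<le> 2 * real (k * m) + 3 * real m"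
      by linarith+
    then have "0 \<le> (real n - 2 * real (k * m)) / real n"
      "(real n - 2 * real (k * m)) / real n \<le> 3 * real m / real n"
      by (intro divide_nonneg_nonneg divide_right_mono; simp)+
    then show ?thesis
      using that unfolding k_def[symmetric] by (simp add: diff_divide_distrib)
  qed
  have "(\<lambda>n. 1 - 2 * real (((n - m) div (2 * m)) * m) / real n) \<longlonglongrightarrow> 0"
  proof (rule tendsto_sandwich)
    show "\<forall>\<^sub>F n in sequentially. 0 \<le> 1 - 2 * real (((n - m) div (2 * m)) * m) / real n"
      "\<forall>\<^sub>F n in sequentially.
        1 - 2 * real (((n - m) div (2 * m)) * m) / real n \<le> 3 * real m / real n"
      using eventually_gt_at_top[of 0] by (eventually_elim; use bounds in blast)+
    show "(\<lambda>n. 3 * real m / real n) \<longlonglongrightarrow> 0"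
      by (rule lim_const_over_n)
  qed simp
  then show "((\<lambda>n. (1 - 2 * real (((n - m) div (2 * m)) * m) / real n) / 1) \<longlongrightarrow> 0) sequentially"
    by simp
qed simp

theorem theorem11:
  fixes G :: cgg and s :: nat and v :: "nat \<Rightarrow> real^2"
  assumes "s \<ge> 1"
    and "plane_convex_caterpillar G"
    and "clockwise_spine G s v"
    and "\<forall>i\<in>{2..s}. \<forall>x. leaf G x \<longrightarrow> {v i, x} \<notin> edges G"
    and "s * (s + 3) \<le> 2 * num_edges G"
  shows "strongly_packable G"
proof -
  obtain N w b where G: "cyclic_enum G N w" "edges G = (`) w ` parent_edges s b N" and "s + b < N"
    using caterpillar_structure[OF assms(1-4)] by metis
  define a where "a = N - Suc (s + b)"
  have N: "N = Suc (s + b + a)" using \<open>s + b < N\<close> by (simp add: a_def)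
  define m where "m = s + b + a"
  have "inj_on w {..<N}" using G by (simp add: cyclic_enum_def)
  then have "inj_on ((`) w) (parent_edges s b N)"
    using inj_on_image_Pow inj_on_subset parent_edges_subset by metis
  then have m: "num_edges G = m"
    by (simp add: num_edges_def G(2) card_image card_parent_edges N m_def)
  have "m > 0" using assms(1) by (simp add: m_def)
  define A where "A = packing_set s (min a b) (max a b)"
  have sum_eq: "s + min a b + max a b = m" by (simp add: m_def min_def max_def)
  define k where "k n = (n - m) div (2 * m)" for n
  define S where "S n = A (k n) ` {..<k n}" for n
  have room: "2 * m * k n + m \<le> n" if "t < k n" for t n
  proof -
    have "2 * m * k n \<le> n - m" by (simp add: k_def)
    moreover have "m \<le> n" using that by (cases "m \<le> n") (auto simp: k_def)
    ultimately show ?thesis by linarith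
  qed
  have card_A: "card (A (k n) t) = m" if "t < k n" for t n
    using card_packing_set[OF that] sum_eq by (simp add: A_def)
  have disj: "A (k n) t \<inter> A (k n) t' = {}" if "t < k n" "t' < k n" "t \<noteq> t'" for t t' n
    unfolding A_def by (rule disjoint_packing_sets[OF that])
  have S_sub: "S n \<subseteq> Pow {1..n div 2}" for n
  proof -
    have "A (k n) t \<subseteq> {1..n div 2}" if "t < k n" for t
    proof -
      have "m * k n \<le> n div 2" using room[OF that] by linarith
      then show ?thesis
        using packing_set_subset[OF that, of s "min a b" "max a b"] sum_eq by (auto simp: A_def)
    qed
    then show ?thesis by (auto simp: S_def)
  qed
  have S_disj: "disjoint (S n)" for n
    using disj by (auto simp: S_def disjoint_def)
  have S_card: "\<forall>B\<in>S n. card B = num_edges G" for n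
    using card_A m by (auto simp: S_def)
  have S_real: "\<exists>H. cgg_subgraph H K \<and> convex_isomorphic H G \<and> length_set K H = B"
    if "B \<in> S n" "complete_cgg n K" for n B K
    using that packing_set_embedding[OF G N that(2) assms(1)] assms(5) room m
    by (auto simp: S_def A_def m_def)
  have S_sum: "real (\<Sum>B\<in>S n. card B) = (1 - (1 - 2 * real (k n * m) / real n)) * (real n / 2)"
    if "n \<ge> 1" for n
  proof -
    have "inj_on (A (k n)) {..<k n}"
    proof (rule inj_onI, rule ccontr)
      fix t t' assume t: "t \<in> {..<k n}" "t' \<in> {..<k n}" "A (k n) t = A (k n) t'" "t \<noteq> t'"
      then have "A (k n) t = {}" using disj[of t n t'] by auto
      then show False using card_A[of t n] t \<open>m > 0\<close> by simp
    qed
    then have "(\<Sum>B\<in>S n. card B) = k n * m"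
      using card_A by (simp add: S_def sum.reindex)
    then show ?thesis using that by simp
  qed
  have S_o: "(\<lambda>n. 1 - 2 * real (k n * m) / real n) \<in> o(\<lambda>_. 1)"
    using covered_fraction_smallo[OF \<open>m > 0\<close>] by (simp add: k_def)
  show ?thesis
    unfolding strongly_packable_def
    by (intro exI[of _ S] conjI allI impI ballI
        exI[of _ "\<lambda>n. 1 - 2 * real (k n * m) / real n"])
      (use S_sub S_disj S_card S_real S_sum S_o in simp_all)
qed

end
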